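(* Let $M$ be an orientable surface in $\mathbb H^3$ oriented by a unit normal vector field $\eta$ and let $\mathcal N:M\to\mathbb S^5\subseteq\mathfrak o(1,3)$ be its Gauss map. Then for any $p\in M$ and $X,Y\in T_pM$, $$\langle d\mathcal N_p(X),\Gamma_p(Y)\rangle=-\langle A_\eta(X),Y\rangle,$$ where $A_\eta$ is the shape operator of $M$.
   Context: On $\mathbb R^4$ let $(x*y)=-x_1y_1+x_2y_2+x_3y_3+x_4y_4$; $\mathbb H^3=\{x:(x*x)=-1,\ x_1>0\}$ with the induced metric (curvature $-1$). $O(1,3)$ is the group of linear maps preserving $( * )$ and mapping $\mathbb H^3$ to itself, with Lie algebra $\mathfrak o(1,3)$ and the bi-invariant pseudo-Riemannian metric determined by $\langle u,v\rangle=\frac12\operatorname{tr}(uv)$ on $\mathfrak o(1,3)$. $O(3)$ is the subgroup fixing $e_1$, and $\mathbb H^3=O(1,3)/O(3)$ isometrically via $\pi(x)=xe_1$. $\mathbb S^5=\{V\in\mathfrak o(1,3):\langle V,V\rangle=1\}$ is the unit pseudo-sphere. For $x\in O(1,3)$ let $\ell_x$ be the restriction of $d\pi_x$ to $(T_x(xO(3)))^\perp$, a linear isometry onto $T_{\pi(x)}\mathbb H^3$. For $p\in\mathbb H^3$, $\Gamma_p:T_p\mathbb H^3\to\mathfrak o(1,3)$ is $\Gamma_p(u)=d(R_{x^{-1}})_x\ell_x^{-1}(u)$ for any $x\in\pi^{-1}(p)$, where $R_y(z)=zy$ (independent of $x$). Surfaces are immersed, and points of $M$ are identified with their images. The Gauss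 map is $\mathcal N(p)=\Gamma_p(\eta(p))$. The shape operator is $A_\eta(X)=-\nabla_X\eta$. *)

theory Defs
  imports "HOL-Analysis.Analysis"
begin

subsection \<open>Lorentz space, hyperbolic space and the Lorentz group\<close>

definition lor :: "real^4 \<Rightarrow> real^4 \<Rightarrow> real" where
  "lor x y = - (x$1 * y$1) + x$2 * y$2 + x$3 * y$3 + x$4 * y$4"

definition H3 :: "(real^4) set" where
  "H3 = {x. lor x x = -1 \<and> x$1 > 0}"

definition O13 :: "(real^4^4) set" where
  "O13 = {A. (\<forall>x y. lor (A *v x) (A *v y) = lor x y) \<and> (\<lambda>x. A *v x) ` H3 \<subseteq> H3}"

definition e1 :: "real^4" where
  "e1 = axis 1 1"

definition O3 :: "(real^4^4) set" where
  "O3 = {A \<in> O13. A *v e1 = e1}"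

text \<open>The tangent space at \<open>p\<close> of an embedded submanifold \<open>S\<close> of a Euclidean space, as the
  set of velocities of curves in \<open>S\<close>. It is used below only for \<open>H3\<close>, \<open>O13\<close> and the left cosets
  of \<open>O3\<close>.\<close>

definition tangent_space :: "'a::euclidean_space set \<Rightarrow> 'a \<Rightarrow> 'a set" where
  "tangent_space S p =
     {v. \<exists>c::real \<Rightarrow> 'a. (\<forall>t. c t \<in> S) \<and> c 0 = p \<and> (c has_vector_derivative v) (at 0)}"

text \<open>\<open>lie_form\<close> is the form on the Lie algebra of \<open>O13\<close>, a space of matrices; being invariant under
  conjugation, its left translate \<open>group_metric\<close> is bi-invariant.\<close>

definition lie_form :: "real^4^4 \<Rightarrow> real^4^4 \<Rightarrow> real" where
  "lie_form u v = trace (u ** v) / 2"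

definition group_metric :: "real^4^4 \<Rightarrow> real^4^4 \<Rightarrow> real^4^4 \<Rightarrow> real" where
  "group_metric x a b = lie_form (matrix_inv x ** a) (matrix_inv x ** b)"

subsection \<open>The maps \<open>\<Gamma>\<^sub>p\<close>\<close>

definition proj_H3 :: "real^4^4 \<Rightarrow> real^4" where
  "proj_H3 x = x *v e1"

definition left_coset :: "real^4^4 \<Rightarrow> (real^4^4) set" where
  "left_coset x = (\<lambda>k. x ** k) ` O3"

definition horizontal :: "real^4^4 \<Rightarrow> (real^4^4) set" where
  "horizontal x =
     {a \<in> tangent_space O13 x. \<forall>b \<in> tangent_space (left_coset x) x. group_metric x a b = 0}"

text \<open>\<open>proj_H3\<close> and right translations are restrictions of linear maps on all matrices, so their
  differentials are the restrictions of the ambient Frechet derivatives.\<close>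

definition ell_inv :: "real^4^4 \<Rightarrow> real^4 \<Rightarrow> real^4^4" where
  "ell_inv x = inv_into (horizontal x) (frechet_derivative proj_H3 (at x))"

definition right_translation :: "real^4^4 \<Rightarrow> real^4^4 \<Rightarrow> real^4^4" where
  "right_translation y z = z ** y"

text \<open>The value of \<open>Gamma_map\<close> does not depend on the choice of \<open>x\<close> in the fibre over \<open>p\<close>.\<close>

definition Gamma_map :: "real^4 \<Rightarrow> real^4 \<Rightarrow> real^4^4" where
  "Gamma_map p u =
     (let x = (SOME x. x \<in> O13 \<and> proj_H3 x = p)
      in frechet_derivative (right_translation (matrix_inv x)) (at x) (ell_inv x u))"

subsection \<open>Smooth surfaces\<close>

primrec Ck_on :: "nat \<Rightarrow> 'a::real_normed_vector set \<Rightarrow> ('a \<Rightarrow> 'b::real_normed_vector) \<Rightarrow> bool" where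
  "Ck_on 0 S f \<longleftrightarrow> continuous_on S f"
| "Ck_on (Suc k) S f \<longleftrightarrow>
     (\<forall>x\<in>S. f differentiable (at x)) \<and> (\<forall>v. Ck_on k S (\<lambda>x. frechet_derivative f (at x) v))"

text \<open>Only meaningful for open \<open>S\<close>.\<close>

definition smooth_on :: "'a::real_normed_vector set \<Rightarrow> ('a \<Rightarrow> 'b::real_normed_vector) \<Rightarrow> bool" where
  "smooth_on S f \<longleftrightarrow> (\<forall>k. Ck_on k S f)"

text \<open>A chart consists of its domain and its coordinate map.\<close>

type_synonym 'm chart = "'m set \<times> ('m \<Rightarrow> real^2)"

definition param :: "'m chart \<Rightarrow> real^2 \<Rightarrow> 'm" where
  "param c = inv_into (fst c) (snd c)"

definition is_chart :: "'m::topological_space chart \<Rightarrow> bool" where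
  "is_chart c \<longleftrightarrow> open (fst c) \<and> open (snd c ` fst c) \<and>
     homeomorphism (fst c) (snd c ` fst c) (snd c) (param c)"

definition smooth_surface ::
  "'m::{t2_space,second_countable_topology} set \<Rightarrow> 'm chart set \<Rightarrow> bool" where
  "smooth_surface M \<A> \<longleftrightarrow> M = (\<Union>c\<in>\<A>. fst c) \<and> (\<forall>c\<in>\<A>. is_chart c) \<and>
     (\<forall>c\<in>\<A>. \<forall>d\<in>\<A>. smooth_on (snd c ` (fst c \<inter> fst d)) (snd d \<circ> param c))"

definition smooth_map :: "'m chart set \<Rightarrow> ('m \<Rightarrow> 'b::real_normed_vector) \<Rightarrow> bool" where
  "smooth_map \<A> g \<longleftrightarrow> (\<forall>c\<in>\<A>. smooth_on (snd c ` fst c) (g \<circ> param c))"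

definition charts_at :: "'m chart set \<Rightarrow> 'm \<Rightarrow> 'm chart set" where
  "charts_at \<A> p = {c \<in> \<A>. p \<in> fst c}"

text \<open>A tangent vector of an abstract surface at \<open>p\<close> assigns to every chart around \<open>p\<close> a coordinate
  vector, subject to the transformation rule under change of charts (and 0 to anything else).\<close>

definition surface_tangent :: "'m chart set \<Rightarrow> 'm \<Rightarrow> ('m chart \<Rightarrow> real^2) set" where
  "surface_tangent \<A> p =
     {X. (\<forall>c. c \<notin> charts_at \<A> p \<longrightarrow> X c = 0) \<and>
         (\<forall>c\<in>charts_at \<A> p. \<forall>d\<in>charts_at \<A> p.
            X d = frechet_derivative (snd d \<circ> param c) (at (snd c p)) (X c))}"

text \<open>The differential at \<open>p\<close> of a map from the surface to a vector space; by the transformation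
  rule any chart around \<open>p\<close> gives the same value.\<close>

definition differential ::
  "'m chart set \<Rightarrow> ('m \<Rightarrow> 'b::real_normed_vector) \<Rightarrow> 'm \<Rightarrow> ('m chart \<Rightarrow> real^2) \<Rightarrow> 'b" where
  "differential \<A> g p X =
     (let c = (SOME c. c \<in> charts_at \<A> p)
      in frechet_derivative (g \<circ> param c) (at (snd c p)) (X c))"

subsection \<open>Surfaces immersed in \<open>H3\<close>\<close>

definition immersed_in_H3 :: "'m set \<Rightarrow> 'm chart set \<Rightarrow> ('m \<Rightarrow> real^4) \<Rightarrow> bool" where
  "immersed_in_H3 M \<A> F \<longleftrightarrow> F ` M \<subseteq> H3 \<and> smooth_map \<A> F \<and>
     (\<forall>p\<in>M. inj_on (differential \<A> F p) (surface_tangent \<A> p))"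

definition unit_normal_field ::
  "'m set \<Rightarrow> 'm chart set \<Rightarrow> ('m \<Rightarrow> real^4) \<Rightarrow> ('m \<Rightarrow> real^4) \<Rightarrow> bool" where
  "unit_normal_field M \<A> F \<eta> \<longleftrightarrow> smooth_map \<A> \<eta> \<and>
     (\<forall>p\<in>M. \<eta> p \<in> tangent_space H3 (F p) \<and> lor (\<eta> p) (\<eta> p) = 1 \<and>
        (\<forall>X\<in>surface_tangent \<A> p. lor (\<eta> p) (differential \<A> F p X) = 0))"

definition gauss_map :: "('m \<Rightarrow> real^4) \<Rightarrow> ('m \<Rightarrow> real^4) \<Rightarrow> 'm \<Rightarrow> real^4^4" where
  "gauss_map F \<eta> p = Gamma_map (F p) (\<eta> p)"

subsection \<open>The Levi-Civita connection of \<open>H3\<close> and the shape operator\<close>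

definition partial :: "'n::finite \<Rightarrow> (real^'n \<Rightarrow> 'b::real_normed_vector) \<Rightarrow> real^'n \<Rightarrow> 'b" where
  "partial i f y = frechet_derivative f (at y) (axis i 1)"

text \<open>The Christoffel symbol \<open>\<Gamma>\<^sup>k\<^sub>i\<^sub>j\<close> of the metric with coordinate matrix \<open>g\<close>.\<close>

definition christoffel ::
  "(real^'n \<Rightarrow> real^'n^'n) \<Rightarrow> 'n::finite \<Rightarrow> 'n \<Rightarrow> 'n \<Rightarrow> real^'n \<Rightarrow> real" where
  "christoffel g k i j y =
     (\<Sum>l\<in>UNIV. matrix_inv (g y) $ k $ l *
        (partial i (\<lambda>z. g z $ j $ l) y + partial j (\<lambda>z. g z $ i $ l) y
          - partial l (\<lambda>z. g z $ i $ j) y)) / 2"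

text \<open>\<open>H3\<close> is the graph of \<open>y \<mapsto> sqrt (1 + |y|\<^sup>2)\<close> over \<open>real^3\<close>; this gives a global chart, in which
  we express the induced metric and its Levi-Civita connection.\<close>

definition hyp_param :: "real^3 \<Rightarrow> real^4" where
  "hyp_param y = vector [sqrt (1 + y \<bullet> y), y$1, y$2, y$3]"

definition hyp_coord :: "real^4 \<Rightarrow> real^3" where
  "hyp_coord x = vector [x$2, x$3, x$4]"

definition hyp_metric :: "real^3 \<Rightarrow> real^3^3" where
  "hyp_metric y = (\<chi> i j. lor (partial i hyp_param y) (partial j hyp_param y))"

text \<open>For a field \<open>V\<close> along \<open>F\<close> tangent to \<open>H3\<close>, \<open>nabla \<A> F V p X\<close> is \<open>\<nabla>\<^sub>X V\<close>, whose
  \<open>k\<close>-th coordinate is \<open>X(V\<^sup>k) + \<Sum>\<^sub>i\<^sub>j \<Gamma>\<^sup>k\<^sub>i\<^sub>j dF(X)\<^sup>i V\<^sup>j\<close>. As \<open>hyp_coord\<close> is linear, it is its own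
  differential, and so \<open>hyp_coord (V q)\<close> are the components of the vector \<open>V q\<close>.\<close>

definition nabla ::
  "'m chart set \<Rightarrow> ('m \<Rightarrow> real^4) \<Rightarrow> ('m \<Rightarrow> real^4) \<Rightarrow> 'm \<Rightarrow> ('m chart \<Rightarrow> real^2) \<Rightarrow> real^4" where
  "nabla \<A> F V p X =
     frechet_derivative hyp_param (at (hyp_coord (F p)))
       (\<chi> k. differential \<A> (\<lambda>q. hyp_coord (V q)) p X $ k +
          (\<Sum>i\<in>UNIV. \<Sum>j\<in>UNIV. christoffel hyp_metric k i j (hyp_coord (F p)) *
             (differential \<A> (\<lambda>q. hyp_coord (F q)) p X $ i) * (hyp_coord (V p) $ j)))"

definition shape_operator ::
  "'m chart set \<Rightarrow> ('m \<Rightarrow> real^4) \<Rightarrow> ('m \<Rightarrow> real^4) \<Rightarrow> 'm \<Rightarrow> ('m chart \<Rightarrow> real^2) \<Rightarrow> real^4" where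
  "shape_operator \<A> F \<eta> p X = - nabla \<A> F \<eta> p X"

end

theory Submission
  imports Defs
begin

text \<open>
  The idea is to make \<open>\<Gamma>\<^sub>p\<close> explicit. The translations along the geodesic with velocity \<open>u\<close> at \<open>p\<close>
  form a one-parameter group whose generator is the map \<open>z \<mapsto> (u * z) p - (p * z) u\<close>, called
  \<open>wedge p u\<close>. Its right translate to \<open>x\<close> is the horizontal lift of \<open>u\<close> to any \<open>x\<close> over \<open>p\<close>, and so
  \<open>\<Gamma>\<^sub>p(u) = wedge p u\<close> (lemma \<open>Gamma_map_eq_wedge\<close>). In particular \<open>\<Gamma>\<close> is the restriction of a
  bilinear map in \<open>p\<close> and \<open>u\<close>.

  The Gauss map is therefore \<open>wedge F \<eta>\<close>, and the product rule gives
  \<open>dN(X) = wedge F (d\<eta>(X)) + wedge (dF(X)) \<eta>\<close>. By the formula for the trace form on such matrices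
  (lemma \<open>lie_form_wedge\<close>), pairing with \<open>wedge F (dF(Y))\<close> kills the second summand, because \<open>dF(Y)\<close>
  is orthogonal to \<open>F\<close> and to \<open>\<eta>\<close>, and turns the first one into \<open>(d\<eta>(X) * dF(Y))\<close>, because
  \<open>(F * F) = -1\<close>. Since the Levi-Civita connection of \<open>H3\<close> is the tangential part of the flat
  derivative (lemma \<open>nabla_eq\<close>), this is \<open>(\<nabla>\<^sub>X \<eta> * dF(Y))\<close>, the negative of the pairing with the
  shape operator.

  Two points need explicit work. The horizontal lift is obtained by choosing a preimage under the
  projection, so it must be shown that the projection is injective on horizontal vectors and that
  \<open>wedge p u ** x\<close> is one of them; since tangent vectors are velocities of curves, this needs concrete
  curves, which are translations and rotations. And the connection is given by Christoffel symbols
  in the graph chart, which are computed in closed form.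
\<close>

section \<open>Matrix algebra\<close>

lemma bounded_linear_matrix_vector_mult_left: "bounded_linear (\<lambda>A::real^'n^'m. A *v v)"
  unfolding linear_conv_bounded_linear[symmetric]
  by (auto intro!: linearI simp: matrix_vector_mult_add_rdistrib scaleR_matrix_vector_assoc)

lemma bounded_linear_matrix_mult_right: "bounded_linear (\<lambda>A::real^'n^'m. A ** (B::real^'k^'n))"
  unfolding linear_conv_bounded_linear[symmetric]
  by (auto intro!: linearI simp: vec_eq_iff matrix_matrix_mult_def
     sum.distrib sum_distrib_left algebra_simps)

lemma bounded_linear_matrix_mult_left: "bounded_linear (\<lambda>A::real^'n^'m. (B::real^'m^'k) ** A)"
  unfolding linear_conv_bounded_linear[symmetric]
  by (auto intro!: linearI simp: vec_eq_iff matrix_matrix_mult_def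
     sum.distrib sum_distrib_left algebra_simps)

lemma matrix_add_rdistrib: "(A + B::real^'n^'m) ** (C::real^'k^'n) = A ** C + B ** C"
  by (rule linear_add[OF bounded_linear.linear[OF bounded_linear_matrix_mult_right]])

lemma matrix_diff_ldistrib: "(C::real^'m^'k) ** (A - B::real^'n^'m) = C ** A - C ** B"
  by (rule linear_diff[OF bounded_linear.linear[OF bounded_linear_matrix_mult_left]])

lemma matrix_diff_rdistrib: "(A - B::real^'n^'m) ** (C::real^'k^'n) = A ** C - B ** C"
  by (rule linear_diff[OF bounded_linear.linear[OF bounded_linear_matrix_mult_right]])

lemma matrix_inv_eqI:
  assumes "(A::real^'n^'n) ** B = mat 1"
  shows "matrix_inv A = B"
proof -
  have "B ** A = mat 1"
    using assms by (rule matrix_left_right_inverse[THEN iffD1])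
  then have "A ** matrix_inv A = mat 1 \<and> matrix_inv A ** A = mat 1"
    unfolding matrix_inv_def by (intro someI[where P = "\<lambda>A'. A ** A' = mat 1 \<and> A' ** A = mat 1"])
      (use assms in simp)
  then have "matrix_inv A ** (A ** B) = B"
    by (simp add: matrix_mul_assoc)
  then show ?thesis
    by (simp add: assms)
qed

section \<open>The Lorentz form and its infinitesimal isometries\<close>

lemma bounded_bilinear_lor: "bounded_bilinear lor"
  unfolding bilinear_conv_bounded_bilinear[symmetric] bilinear_def
  by (auto intro!: linearI simp: lor_def algebra_simps)

interpretation lor: bounded_bilinear lor
  by (rule bounded_bilinear_lor)

lemma lor_commute: "lor x y = lor y x"
  by (simp add: lor_def algebra_simps)

lemma lor_nondegenerate:
  assumes "\<And>w. lor v w = 0"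
  shows "v = 0"
proof -
  have "v $ i = 0" for i
    using assms[of "axis 1 1"] assms[of "axis 2 1"] assms[of "axis 3 1"] assms[of "axis 4 1"]
      exhaust_4[of i]
    by (auto simp: lor_def axis_def)
  then show ?thesis
    by (simp add: vec_eq_iff)
qed

text \<open>As a linear map, \<open>outer p u\<close> is \<open>z \<mapsto> lor u z *\<^sub>R p\<close>. Its antisymmetrization \<open>wedge p u\<close> lies in the
  Lie algebra of \<open>O13\<close>; for \<open>p\<close> in \<open>H3\<close> and \<open>u\<close> tangent there it generates the translation along the
  geodesic through \<open>p\<close> with velocity \<open>u\<close>.\<close>

definition outer :: "real^4 \<Rightarrow> real^4 \<Rightarrow> real^4^4" where
  "outer p u = matrix (\<lambda>z. lor u z *\<^sub>R p)"

definition wedge :: "real^4 \<Rightarrow> real^4 \<Rightarrow> real^4^4" where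
  "wedge p u = outer p u - outer u p"

lemma outer_mult_vec: "outer p u *v z = lor u z *\<^sub>R p"
  by (simp add: outer_def matrix_def matrix_vector_mult_def vec_eq_iff lor_def axis_def sum_4
      algebra_simps)

lemma wedge_mult_vec: "wedge p u *v z = lor u z *\<^sub>R p - lor p z *\<^sub>R u"
  by (simp add: wedge_def outer_mult_vec matrix_vector_mult_diff_rdistrib)

lemma bounded_bilinear_outer: "bounded_bilinear outer"
  unfolding bilinear_conv_bounded_bilinear[symmetric] bilinear_def
  by (auto intro!: linearI simp: outer_def matrix_def vec_eq_iff lor.add_left lor.scaleR_left algebra_simps)

interpretation outer: bounded_bilinear outer
  by (rule bounded_bilinear_outer)

lemma bounded_bilinear_wedge: "bounded_bilinear wedge"
  unfolding bilinear_conv_bounded_bilinear[symmetric] bilinear_def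
  by (auto intro!: linearI simp: wedge_def outer.add_left outer.add_right
        outer.scaleR_left outer.scaleR_right algebra_simps)

lemma mult_outer: "k ** outer p u = outer (k *v p) u"
  by (simp add: matrix_eq matrix_vector_mul_assoc[symmetric] outer_mult_vec
      matrix_vector_mult_scaleR)

lemma trace_outer: "trace (outer p u) = lor u p"
  by (simp add: trace_def outer_def matrix_def lor_def axis_def sum_4)

text \<open>This is why skew-symmetric \<open>k\<close> pair with \<open>wedge p u\<close> through their matrix entry in the plane
  spanned by \<open>p\<close> and \<open>u\<close>; all orthogonality statements below reduce to it.\<close>

lemma trace_mult_wedge: "trace (k ** wedge p u) = lor u (k *v p) - lor p (k *v u)"
  by (simp add: wedge_def matrix_diff_ldistrib mult_outer trace_sub trace_outer)

lemma trace_wedge_mult: "trace (wedge p u ** k) = lor u (k *v p) - lor p (k *v u)"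
  by (subst trace_mul_sym) (rule trace_mult_wedge)

lemma lie_form_wedge: "lie_form (wedge p u) (wedge q v) = lor u q * lor v p - lor u v * lor p q"
  by (simp add: lie_form_def trace_wedge_mult wedge_mult_vec lor.diff_right lor.scaleR_right
      lor_commute[of v u] lor_commute[of q p] lor_commute[of v p] lor_commute[of q u] field_simps)

section \<open>The Lorentz group\<close>

text \<open>By Cauchy--Schwarz the product of the time coordinates dominates the spatial part of
  \<open>lor w q\<close>. So the sheet of the hyperboloid on which \<open>w\<close> lies can be read off from the form, and
  a linear isometry cannot exchange the sheets if it keeps one point of \<open>H3\<close> in \<open>H3\<close>.\<close>

lemma lor_neg_iff:
  assumes "lor w w = -1" "q \<in> H3"
  shows "lor w q < 0 \<longleftrightarrow> w $ 1 > 0"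
proof -
  define s where "s = w$2*q$2 + w$3*q$3 + w$4*q$4"
  define a where "a = (w$2)\<^sup>2 + (w$3)\<^sup>2 + (w$4)\<^sup>2"
  define b where "b = (q$2)\<^sup>2 + (q$3)\<^sup>2 + (q$4)\<^sup>2"
  have w: "(w$1)\<^sup>2 = 1 + a" and q: "(q$1)\<^sup>2 = 1 + b" "q$1 > 0" and l: "lor w q = s - w$1 * q$1"
    using assms by (auto simp: H3_def lor_def a_def b_def s_def power2_eq_square)
  have ab: "a \<ge> 0" "b \<ge> 0"
    by (auto simp: a_def b_def)
  have "a*b - s\<^sup>2 = (w$2*q$3-w$3*q$2)\<^sup>2 + (w$2*q$4-w$4*q$2)\<^sup>2 + (w$3*q$4-w$4*q$3)\<^sup>2"
    unfolding a_def b_def s_def by algebra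
  then have "s\<^sup>2 \<le> a * b"
    by (smt (verit) zero_le_power2)
  also have "\<dots> < (1 + a) * (1 + b)"
    using ab by (simp add: algebra_simps)
  also have "\<dots> = (w$1 * q$1)\<^sup>2"
    by (simp add: power_mult_distrib w q)
  finally have s: "\<bar>s\<bar> < \<bar>w$1 * q$1\<bar>"
    by (metis abs_le_square_iff not_le)
  show ?thesis
  proof (cases "w $ 1 > 0")
    case True
    then have "w$1 * q$1 > 0"
      using q(2) by simp
    then show ?thesis
      using s True unfolding l by linarith
  next
    case False
    then have "w$1 * q$1 \<le> 0"
      using q(2) by (simp add: mult_nonpos_nonneg)
    then show ?thesis
      using s False unfolding l by linarith
  qed
qed

lemma O13I:
  assumes "\<And>x y. lor (A *v x) (A *v y) = lor x y" "p \<in> H3" "A *v p \<in> H3"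
  shows "A \<in> O13"
proof -
  have "A *v z \<in> H3" if "z \<in> H3" for z
  proof -
    have z: "lor z z = -1" "z $ 1 > 0"
      using that by (auto simp: H3_def)
    then have "lor (A *v z) (A *v p) < 0"
      using assms(1,2) lor_neg_iff by simp
    then show ?thesis
      using lor_neg_iff[of "A *v z" "A *v p"] assms(1,3) z by (simp add: H3_def)
  qed
  then show ?thesis
    using assms(1) by (auto simp: O13_def)
qed

lemma O13_lor: "A \<in> O13 \<Longrightarrow> lor (A *v x) (A *v y) = lor x y"
  by (simp add: O13_def)

lemma O13_mult: "A \<in> O13 \<Longrightarrow> B \<in> O13 \<Longrightarrow> A ** B \<in> O13"
  by (simp add: O13_def matrix_vector_mul_assoc[symmetric] image_subset_iff)

lemma O13_matrix_inv:
  assumes "A \<in> O13"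
  shows "A ** matrix_inv A = mat 1" "matrix_inv A ** A = mat 1"
proof -
  have "v = 0" if "A *v v = 0" for v
    using O13_lor[OF assms, of v] that by (intro lor_nondegenerate) (simp add: lor.zero_left)
  then have "inj ((*v) A)"
    by (simp add: linear_injective_0)
  then have "invertible A"
    by (simp add: invertible_left_inverse matrix_left_invertible_injective)
  then have "A ** matrix_inv A = mat 1 \<and> matrix_inv A ** A = mat 1"
    unfolding invertible_def matrix_inv_def by (rule someI_ex)
  then show "A ** matrix_inv A = mat 1" "matrix_inv A ** A = mat 1"
    by auto
qed

lemma e1_in_H3: "e1 \<in> H3"
  by (simp add: e1_def H3_def lor_def axis_def)

text \<open>The product of the reflection in the hyperplane orthogonal to \<open>p\<close> and the one in the hyperplane
  orthogonal to \<open>p + q\<close>, that is, the translation along the geodesic from \<open>p\<close> to \<open>q\<close>. Being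
  rational in \<open>q\<close>, it gives both the transitivity of \<open>O13\<close> on \<open>H3\<close> and explicit curves in \<open>O13\<close>
  that lift curves in \<open>H3\<close>, without the matrix exponential.\<close>

definition transvection :: "real^4 \<Rightarrow> real^4 \<Rightarrow> real^4^4" where
  "transvection p q =
     mat 1 - 2 *\<^sub>R outer q p + inverse (1 - lor p q) *\<^sub>R outer (p + q) (p + q)"

lemma transvection_mult_vec:
  "transvection p q *v z = z - (2 * lor p z) *\<^sub>R q + (lor (p + q) z / (1 - lor p q)) *\<^sub>R (p + q)"
  by (simp add: transvection_def matrix_vector_mult_diff_rdistrib matrix_vector_mult_add_rdistrib
      outer_mult_vec scaleR_matrix_vector_assoc[symmetric] divide_inverse mult.commute)

lemma H3_lor: "p \<in> H3 \<Longrightarrow> lor p p = -1"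
  by (simp add: H3_def)

lemma H3_lor_neg: "p \<in> H3 \<Longrightarrow> q \<in> H3 \<Longrightarrow> lor p q < 0"
  using lor_neg_iff by (auto simp: H3_def)

lemma transvection_maps: 
  assumes "p \<in> H3" "q \<in> H3"
  shows "transvection p q *v p = q"
proof -
  have "lor (p + q) p / (1 - lor p q) = -1"
    using H3_lor[OF assms(1)] H3_lor_neg[OF assms]
    by (simp add: lor.add_left lor_commute[of q] field_simps)
  then show ?thesis
    by (simp add: transvection_mult_vec H3_lor assms scaleR_2)
qed

lemma transvection_in_O13:
  assumes "p \<in> H3" "q \<in> H3"
  shows "transvection p q \<in> O13"
proof (rule O13I[OF _ assms(1)])
  show "transvection p q *v p \<in> H3"
    using assms by (simp add: transvection_maps)
next
  fix x y
  define d where "d = 1 - lor p q"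
  define b where "b z = lor (p + q) z / d" for z
  have d: "lor p q = 1 - d" "lor q p = 1 - d"
    by (auto simp: d_def lor_commute)
  have "d \<noteq> 0"
    using H3_lor_neg[OF assms] by (simp add: d_def)
  then have b: "lor q z = b z * d - lor p z" for z
    by (simp add: b_def lor.add_left)
  have "lor (transvection p q *v x) (transvection p q *v y)
      = lor x y - 2 * lor p y * lor q x - 2 * lor p x * lor q y - 4 * lor p x * lor p y
        + b y * (lor p x + lor q x) + b x * (lor p y + lor q y)
        + 2 * lor p x * (b y * d) + 2 * lor p y * (b x * d) - 2 * d * b x * b y"
    unfolding transvection_mult_vec d_def[symmetric] b_def[symmetric]
    by (simp add: lor.add_left lor.add_right lor.diff_left lor.diff_right lor.scaleR_left
        lor.scaleR_right lor_commute[of x p] lor_commute[of y p] lor_commute[of x q]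
        lor_commute[of y q] d H3_lor assms algebra_simps)
  also have "\<dots> = lor x y"
    by (simp add: b algebra_simps)
  finally show "lor (transvection p q *v x) (transvection p q *v y) = lor x y" .
qed

lemma tangent_space_H3_orthogonal:
  assumes "u \<in> tangent_space H3 p"
  shows "lor p u = 0"
proof -
  obtain c where c: "\<And>t. c t \<in> H3" "c 0 = p" "(c has_vector_derivative u) (at 0)"
    using assms by (auto simp: tangent_space_def)
  have "((\<lambda>t. lor (c t) (c t)) has_vector_derivative lor (c 0) u + lor u (c 0)) (at 0)"
    by (intro lor.has_vector_derivative c)
  moreover have "(\<lambda>t. lor (c t) (c t)) = (\<lambda>t. -1)"
    by (simp add: c H3_lor)
  ultimately have "lor (c 0) u + lor u (c 0) = 0"
    by (metis has_vector_derivative_const vector_derivative_unique_at)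
  then show ?thesis
    by (simp add: c lor_commute)
qed

lemma outer_double: "outer (p + p) u = 2 *\<^sub>R outer p u" "outer u (p + p) = 2 *\<^sub>R outer u p"
  by (simp_all only: outer.add_left outer.add_right scaleR_2)

text \<open>The scalar factor is stationary at \<open>q = p\<close> because \<open>u\<close> is orthogonal to \<open>p\<close>. The symmetric parts
  of the two remaining terms then cancel.\<close>

lemma transvection_has_vector_derivative:
  assumes "\<And>t. c t \<in> H3" "c 0 = p" "(c has_vector_derivative u) (at 0)"
  shows "((\<lambda>t. transvection p (c t)) has_vector_derivative wedge p u) (at 0)"
proof -
  have p: "p \<in> H3"
    using assms(1,2) by metis
  have pu: "lor p u = 0"
    using assms by (intro tangent_space_H3_orthogonal) (auto simp: tangent_space_def)
  have s: "((\<lambda>t. p + c t) has_vector_derivative u) (at 0)"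
    using has_vector_derivative_add[OF has_vector_derivative_const assms(3)] by simp
  have l: "((\<lambda>t. lor p (c t)) has_vector_derivative 0) (at 0)"
    using lor.has_vector_derivative[OF has_vector_derivative_const assms(3), of p]
    by (simp add: pu lor.zero_left)
  have "((\<lambda>t. inverse (1 - lor p (c t))) has_vector_derivative 0) (at 0)"
  proof -
    have "((\<lambda>t. lor p (c t)) has_real_derivative 0) (at 0)"
      using l by (simp add: has_real_derivative_iff_has_vector_derivative)
    moreover have "1 - lor p (c 0) \<noteq> 0"
      using p by (simp add: assms H3_lor)
    ultimately have "((\<lambda>t. inverse (1 - lor p (c t))) has_real_derivative 0) (at 0)"
      by (auto intro!: derivative_eq_intros)
    then show ?thesis
      by (simp add: has_real_derivative_iff_has_vector_derivative)
  qed
  from bounded_bilinear.has_vector_derivative[OF bounded_bilinear_scaleR this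
      outer.has_vector_derivative[OF s s]]
  have 1: "((\<lambda>t. inverse (1 - lor p (c t)) *\<^sub>R outer (p + c t) (p + c t)) has_vector_derivative
     (outer p u + outer u p)) (at 0)"
    unfolding assms(2) outer_double using p by (simp add: H3_lor scaleR_right_distrib[symmetric])
  have 2: "((\<lambda>t. 2 *\<^sub>R outer (c t) p) has_vector_derivative 2 *\<^sub>R outer u p) (at 0)"
    using outer.has_vector_derivative[OF assms(3) has_vector_derivative_const, of p]
    by (intro bounded_linear.has_vector_derivative[OF bounded_linear_scaleR_right]) (simp add: outer.zero_right)
  from has_vector_derivative_add[OF has_vector_derivative_diff[OF has_vector_derivative_const 2] 1]
  show ?thesis
    unfolding transvection_def by (simp add: wedge_def scaleR_2)
qed

lemma transvection_self: "p \<in> H3 \<Longrightarrow> transvection p p = mat 1"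
  unfolding transvection_def outer_double by (simp add: H3_lor)

lemma wedge_mult_in_tangent_space_O13:
  assumes "p \<in> H3" "u \<in> tangent_space H3 p" "x \<in> O13"
  shows "wedge p u ** x \<in> tangent_space O13 x"
proof -
  obtain c where c: "\<And>t. c t \<in> H3" "c 0 = p" "(c has_vector_derivative u) (at 0)"
    using assms(2) by (auto simp: tangent_space_def)
  have "((\<lambda>t. transvection p (c t) ** x) has_vector_derivative wedge p u ** x) (at 0)"
    by (intro bounded_linear.has_vector_derivative[OF bounded_linear_matrix_mult_right]
        transvection_has_vector_derivative c)
  moreover have "transvection p (c t) ** x \<in> O13" for t
    by (intro O13_mult transvection_in_O13 assms c)
  moreover have "transvection p (c 0) ** x = x"
    by (simp add: c transvection_self assms)
  ultimately show ?thesis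
    unfolding tangent_space_def by (intro CollectI exI[of _ "\<lambda>t. transvection p (c t) ** x"]) auto
qed

lemma tangent_space_O13_skew:
  assumes "b \<in> tangent_space O13 x"
  shows "lor (b *v v) (x *v w) + lor (x *v v) (b *v w) = 0"
proof -
  obtain c where c: "\<And>t. c t \<in> O13" "c 0 = x" "(c has_vector_derivative b) (at 0)"
    using assms by (auto simp: tangent_space_def)
  have "((\<lambda>t. lor (c t *v v) (c t *v w)) has_vector_derivative
      lor (c 0 *v v) (b *v w) + lor (b *v v) (c 0 *v w)) (at 0)"
    by (intro lor.has_vector_derivative
        bounded_linear.has_vector_derivative[OF bounded_linear_matrix_vector_mult_left] c)
  moreover have "(\<lambda>t. lor (c t *v v) (c t *v w)) = (\<lambda>t. lor v w)"
    by (simp add: c O13_lor)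
  ultimately have "lor (c 0 *v v) (b *v w) + lor (b *v v) (c 0 *v w) = 0"
    by (metis has_vector_derivative_const vector_derivative_unique_at)
  then show ?thesis
    by (simp add: c)
qed

section \<open>Horizontal lifts\<close>

lemma tangent_space_mono: "S \<subseteq> T \<Longrightarrow> tangent_space S p \<subseteq> tangent_space T p"
  unfolding tangent_space_def by (intro Collect_mono) (metis subsetD)

lemma left_coset_subset: "x \<in> O13 \<Longrightarrow> left_coset x \<subseteq> O13"
  by (auto simp: left_coset_def O3_def intro: O13_mult)

lemma tangent_space_left_coset_vertical:
  assumes "b \<in> tangent_space (left_coset x) x"
  shows "b *v e1 = 0"
proof -
  obtain c where c: "\<And>t. c t \<in> left_coset x" "c 0 = x" "(c has_vector_derivative b) (at 0)"
    using assms by (auto simp: tangent_space_def)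
  have "((\<lambda>t. c t *v e1) has_vector_derivative b *v e1) (at 0)"
    by (intro bounded_linear.has_vector_derivative[OF bounded_linear_matrix_vector_mult_left] c)
  moreover have "c t *v e1 = x *v e1" for t
    using c(1)[of t] by (auto simp: left_coset_def O3_def matrix_vector_mul_assoc[symmetric])
  ultimately have "((\<lambda>t. x *v e1) has_vector_derivative b *v e1) (at 0)"
    by simp
  then show ?thesis
    by (metis has_vector_derivative_const vector_derivative_unique_at)
qed

lemma matrix_inv_mult_vec:
  assumes "x \<in> O13"
  shows "x *v (matrix_inv x *v v) = v" "matrix_inv x *v (x *v v) = v"
  by (simp_all add: matrix_vector_mul_assoc O13_matrix_inv assms)

lemma matrix_inv_mult:
  assumes "x \<in> O13"
  shows "x ** (matrix_inv x ** b) = b" "matrix_inv x ** (x ** b) = b"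
  by (simp_all add: matrix_mul_assoc O13_matrix_inv assms)

text \<open>If \<open>b\<close> is vertical, then \<open>b ** matrix_inv x\<close> is skew-symmetric and annihilates \<open>p\<close>; its trace
  against \<open>wedge p u\<close> only involves entries with one index in the direction \<open>p\<close>, and these vanish.\<close>

lemma wedge_mult_in_horizontal:
  assumes "x \<in> O13" "x *v e1 = p" "u \<in> tangent_space H3 p"
  shows "wedge p u ** x \<in> horizontal x"
proof -
  have p: "p \<in> H3"
    using assms e1_in_H3 by (auto simp: O13_def)
  have "group_metric x (wedge p u ** x) b = 0" if b: "b \<in> tangent_space (left_coset x) x" for b
  proof -
    define m where "m = b ** matrix_inv x"
    have mp: "m *v p = 0"
      by (simp add: m_def matrix_vector_mul_assoc[symmetric] assms(1) matrix_inv_mult_vec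
          tangent_space_left_coset_vertical[OF b] flip: assms(2))
    have "b \<in> tangent_space O13 x"
      using b tangent_space_mono[OF left_coset_subset[OF assms(1)]] by blast
    from tangent_space_O13_skew[OF this, of "matrix_inv x *v p" "matrix_inv x *v u"]
    have "lor (m *v p) u + lor p (m *v u) = 0"
      by (simp add: m_def matrix_vector_mul_assoc[symmetric] matrix_inv_mult_vec assms(1))
    then have mu: "lor p (m *v u) = 0"
      by (simp add: mp lor.zero_left)
    have "trace (matrix_inv x ** (wedge p u ** x) ** (matrix_inv x ** b))
        = trace (matrix_inv x ** (wedge p u ** b))"
      by (simp add: matrix_mul_assoc[symmetric] matrix_inv_mult assms(1))
    also have "\<dots> = trace (wedge p u ** m)"
      unfolding m_def by (subst trace_mul_sym) (simp add: matrix_mul_assoc)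
    also have "\<dots> = 0"
      by (simp add: trace_wedge_mult mp mu lor.zero_right)
    finally show ?thesis
      by (simp add: group_metric_def lie_form_def)
  qed
  then show ?thesis
    using wedge_mult_in_tangent_space_O13[OF p assms(3,1)] by (simp add: horizontal_def)
qed

text \<open>The curve is the rotation by the angle \<open>t\<close> in the plane spanned by \<open>u\<close> and \<open>v\<close>.\<close>

lemma wedge_in_tangent_space_O3:
  assumes "lor u u = 1" "lor v v = 1" "lor u v = 0" "lor u e1 = 0" "lor v e1 = 0"
  shows "wedge u v \<in> tangent_space O3 (mat 1)"
proof -
  define k where "k t = mat 1 + (cos t - 1) *\<^sub>R (outer u u + outer v v) + sin t *\<^sub>R wedge u v" for t
  have kz: "k t *v z = z + (cos t - 1) *\<^sub>R (lor u z *\<^sub>R u + lor v z *\<^sub>R v)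
      + sin t *\<^sub>R (lor v z *\<^sub>R u - lor u z *\<^sub>R v)" for t z
    by (simp add: k_def matrix_vector_mult_add_rdistrib outer_mult_vec wedge_mult_vec
      scaleR_matrix_vector_assoc[symmetric])
  have ke: "k t *v e1 = e1" for t
    by (simp add: kz assms)
  have "lor (k t *v x) (k t *v y) = lor x y" for t x y
  proof -
    define a where "a = cos t - 1"
    define s where "s = sin t"
    have as: "a\<^sup>2 + 2 * a + s\<^sup>2 = 0"
      using sin_cos_squared_add[of t] by (simp add: a_def s_def power2_eq_square algebra_simps)
    \<comment> \<open>The factor in front of the correction vanishes since \<open>a + 1\<close> and \<open>s\<close> are a cosine and a sine.\<close>
    have "lor (k t *v x) (k t *v y)
        = lor x y + (a\<^sup>2 + 2 * a + s\<^sup>2) * (lor u x * lor u y + lor v x * lor v y)"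
      unfolding kz a_def[symmetric] s_def[symmetric]
      by (simp add: lor.add_left lor.add_right lor.diff_left lor.diff_right lor.scaleR_left
        lor.scaleR_right lor_commute[of x u] lor_commute[of y u] lor_commute[of x v]
        lor_commute[of y v] lor_commute[of v u] assms algebra_simps power2_eq_square)
    then show ?thesis
      by (simp add: as)
  qed
  then have "k t \<in> O3" for t
    using O13I[OF _ e1_in_H3, of "k t"] e1_in_H3 by (simp add: O3_def ke)
  moreover have "(k has_vector_derivative wedge u v) (at 0)"
    unfolding k_def by (auto intro!: derivative_eq_intros)
  moreover have "k 0 = mat 1"
    by (simp add: k_def)
  ultimately show ?thesis
    by (auto simp: tangent_space_def)
qed

text \<open>The difference of two horizontal vectors with the same image, pulled back to the identity, is a
  skew-symmetric \<open>d\<close> that annihilates \<open>e1\<close>, hence an infinitesimal rotation of the spatial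
  coordinates. Orthogonality to the rotations in the three spatial coordinate planes removes its
  remaining entries.\<close>

lemma proj_H3_inj_on_horizontal:
  assumes "x \<in> O13"
  shows "inj_on (\<lambda>a. a *v e1) (horizontal x)"
proof (rule inj_onI)
  fix a b
  assume ab: "a \<in> horizontal x" "b \<in> horizontal x" "a *v e1 = b *v e1"
  define d where "d = matrix_inv x ** (a - b)"
  have xd: "x ** d = a - b"
    by (simp add: d_def matrix_mul_assoc O13_matrix_inv assms)
  have skew: "lor (d *v v) w + lor v (d *v w) = 0" for v w
  proof -
    have "lor ((a - b) *v v) (x *v w) + lor (x *v v) ((a - b) *v w) = 0"
      using ab tangent_space_O13_skew[of a x v w] tangent_space_O13_skew[of b x v w]
      by (simp add: horizontal_def matrix_vector_mult_diff_rdistrib lor.diff_left lor.diff_right)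
    then show ?thesis
      by (simp add: xd[symmetric] matrix_vector_mul_assoc[symmetric] O13_lor assms)
  qed
  have de1: "d *v e1 = 0"
    by (simp add: d_def matrix_vector_mul_assoc[symmetric] matrix_vector_mult_diff_rdistrib ab)
  have spatial: "lor v (d *v u) = 0"
    if uv: "lor u u = 1" "lor v v = 1" "lor u v = 0" "lor u e1 = 0" "lor v e1 = 0" for u v
  proof -
    obtain c where c: "\<And>t. c t \<in> O3" "c 0 = mat 1" "(c has_vector_derivative wedge u v) (at 0)"
      using wedge_in_tangent_space_O3[OF uv] by (auto simp: tangent_space_def)
    have "((\<lambda>t. x ** c t) has_vector_derivative x ** wedge u v) (at 0)"
      by (intro bounded_linear.has_vector_derivative[OF bounded_linear_matrix_mult_left] c)
    then have "x ** wedge u v \<in> tangent_space (left_coset x) x"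
      unfolding tangent_space_def
      by (intro CollectI exI[of _ "\<lambda>t. x ** c t"]) (auto simp: c left_coset_def)
    then have "group_metric x a (x ** wedge u v) = 0" "group_metric x b (x ** wedge u v) = 0"
      using ab by (auto simp: horizontal_def)
    then have "trace (d ** wedge u v) = 0"
      by (simp add: matrix_inv_mult assms group_metric_def lie_form_def d_def matrix_diff_ldistrib matrix_diff_rdistrib
          trace_sub)
    then show ?thesis
      using skew[of v u] trace_mult_wedge[of d u v]
      by (simp add: lor_commute)
  qed
  have basis: "lor (axis j 1) (d *v axis i 1) = 0" for i j
  proof (cases "i = 1 \<or> j = 1 \<or> i = j")
    case True
    then show ?thesis
      using de1 skew[of "axis i 1" "axis i 1"] skew[of "axis j 1" "axis i 1"]
      by (auto simp: e1_def lor.zero_left lor.zero_right lor_commute)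
  next
    case False
    then show ?thesis
      using exhaust_4[of i] exhaust_4[of j]
      by (intro spatial) (auto simp: lor_def axis_def e1_def)
  qed
  have "d *v axis i 1 = 0" for i
  proof -
    have "(d *v axis i 1) $ j = 0" for j
      using basis[of 1 i] basis[of 2 i] basis[of 3 i] basis[of 4 i] exhaust_4[of j]
      by (auto simp: lor_def axis_def)
    then show ?thesis
      by (simp add: vec_eq_iff)
  qed
  then have "d = 0"
    by (simp add: vec_eq_iff matrix_vector_mult_basis column_def)
  then show "a = b"
    using xd by (simp add: matrix_matrix_mult_def vec_eq_iff)
qed

text \<open>The horizontal lift of \<open>u\<close> to \<open>x\<close> is \<open>wedge p u ** x\<close>, because \<open>wedge p u *v p = u\<close>. Translating
  back by the inverse of \<open>x\<close> removes \<open>x\<close>, so neither the choice of \<open>x\<close> nor that of a preimage in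
  \<open>ell_inv\<close> is visible in the result.\<close>

lemma Gamma_map_eq_wedge:
  assumes "p \<in> H3" "u \<in> tangent_space H3 p"
  shows "Gamma_map p u = wedge p u"
proof -
  define x where "x = (SOME x. x \<in> O13 \<and> proj_H3 x = p)"
  have "transvection e1 p \<in> O13 \<and> proj_H3 (transvection e1 p) = p"
    by (simp add: proj_H3_def transvection_maps transvection_in_O13 e1_in_H3 assms)
  then have "x \<in> O13 \<and> proj_H3 x = p"
    unfolding x_def by (rule someI)
  then have x: "x \<in> O13" "x *v e1 = p"
    by (auto simp: proj_H3_def)
  have "(proj_H3 has_derivative (\<lambda>a. a *v e1)) (at x)"
    unfolding proj_H3_def
    by (intro bounded_linear_imp_has_derivative bounded_linear_matrix_vector_mult_left)
  then have 1: "frechet_derivative proj_H3 (at x) = (\<lambda>a. a *v e1)"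
    by (rule frechet_derivative_at[symmetric])
  have "(right_translation y has_derivative right_translation y) (at x)" for y
    unfolding right_translation_def
    by (intro bounded_linear_imp_has_derivative bounded_linear_matrix_mult_right)
  then have 2: "frechet_derivative (right_translation y) (at x) = right_translation y" for y
    by (metis frechet_derivative_at)
  have u: "(wedge p u ** x) *v e1 = u"
    using tangent_space_H3_orthogonal[OF assms(2)]
    by (simp add: matrix_vector_mul_assoc[symmetric] x wedge_mult_vec H3_lor assms(1) lor_commute)
  have "ell_inv x u = wedge p u ** x"
    unfolding ell_inv_def 1
    using inv_into_f_f[OF proj_H3_inj_on_horizontal[OF x(1)] wedge_mult_in_horizontal[OF x assms(2)]]
    by (simp add: u)
  then show ?thesis
    by (simp add: Gamma_map_def x_def[symmetric] Let_def 2 right_translation_def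
        matrix_mul_assoc[symmetric] O13_matrix_inv x)
qed

section \<open>Differentials of maps on a surface\<close>

text \<open>The chart in which \<open>differential\<close> evaluates at \<open>p\<close>. With this name, the product rule and
  similar rules can be derived once and the charts need not be mentioned again.\<close>

definition chart_at :: "'m chart set \<Rightarrow> 'm \<Rightarrow> 'm chart" where
  "chart_at \<A> p = (SOME c. c \<in> charts_at \<A> p)"

lemma differential_chart_at:
  "differential \<A> g p X =
     frechet_derivative (g \<circ> param (chart_at \<A> p)) (at (snd (chart_at \<A> p) p)) (X (chart_at \<A> p))"
  by (simp add: differential_def chart_at_def Let_def)

lemma chart_at:
  assumes "smooth_surface M \<A>" "p \<in> M"
  shows "chart_at \<A> p \<in> \<A>" "p \<in> fst (chart_at \<A> p)"
proof -
  have "\<exists>c. c \<in> charts_at \<A> p"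
    using assms by (auto simp: smooth_surface_def charts_at_def)
  then have "chart_at \<A> p \<in> charts_at \<A> p"
    unfolding chart_at_def by (rule someI_ex)
  then show "chart_at \<A> p \<in> \<A>" "p \<in> fst (chart_at \<A> p)"
    by (auto simp: charts_at_def)
qed

lemma chart_image:
  assumes "smooth_surface M \<A>" "c \<in> \<A>"
  shows "open (snd c ` fst c)" "y \<in> snd c ` fst c \<Longrightarrow> param c y \<in> M"
    "p \<in> fst c \<Longrightarrow> param c (snd c p) = p"
proof -
  have c: "open (snd c ` fst c)" "homeomorphism (fst c) (snd c ` fst c) (snd c) (param c)" "fst c \<subseteq> M"
    using assms by (auto simp: smooth_surface_def is_chart_def)
  show "open (snd c ` fst c)"
    by (fact c)
  show "param c y \<in> M" if "y \<in> snd c ` fst c"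
    using that c(2,3) by (auto simp: homeomorphism_def)
  show "param c (snd c p) = p" if "p \<in> fst c"
    using that c(2) by (auto simp: homeomorphism_def)
qed

lemma smooth_map_has_derivative:
  assumes "smooth_surface M \<A>" "p \<in> M" "smooth_map \<A> g"
  shows "(g \<circ> param (chart_at \<A> p) has_derivative (frechet_derivative (g \<circ> param (chart_at \<A> p)) (at (snd (chart_at \<A> p) p))))
     (at (snd (chart_at \<A> p) p))"
proof -
  define c where "c = chart_at \<A> p"
  have c: "c \<in> \<A>" "p \<in> fst c"
    using chart_at[OF assms(1,2)] by (auto simp: c_def)
  then have "Ck_on (Suc 0) (snd c ` fst c) (g \<circ> param c)"
    using assms(3) by (simp only: smooth_map_def smooth_on_def)
  then have "(g \<circ> param c) differentiable (at (snd c p))"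
    using c(2) by simp
  then show ?thesis
    unfolding c_def[symmetric] by (simp only: frechet_derivative_works)
qed

lemma differential_eqI:
  assumes "(g \<circ> param (chart_at \<A> p) has_derivative D) (at (snd (chart_at \<A> p) p))"
  shows "differential \<A> g p X = D (X (chart_at \<A> p))"
  unfolding differential_chart_at frechet_derivative_at[OF assms, symmetric] ..

lemma differential_bounded_linear:
  assumes "smooth_surface M \<A>" "p \<in> M" "smooth_map \<A> g" "bounded_linear L"
  shows "differential \<A> (\<lambda>q. L (g q)) p X = L (differential \<A> g p X)"
  using bounded_linear.has_derivative[OF assms(4) smooth_map_has_derivative[OF assms(1-3)]]
  by (subst differential_eqI) (auto simp: o_def differential_chart_at)

lemma differential_bounded_bilinear:
  assumes "smooth_surface M \<A>" "p \<in> M" "smooth_map \<A> f" "smooth_map \<A> g" "bounded_bilinear B"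
  shows "differential \<A> (\<lambda>q. B (f q) (g q)) p X
    = B (f p) (differential \<A> g p X) + B (differential \<A> f p X) (g p)"
proof -
  have "param (chart_at \<A> p) (snd (chart_at \<A> p) p) = p"
    using chart_at[OF assms(1,2)] chart_image(3)[OF assms(1)] by blast
  then show ?thesis
    using bounded_bilinear.FDERIV[OF assms(5) smooth_map_has_derivative[OF assms(1-3)]
        smooth_map_has_derivative[OF assms(1,2,4)]]
    by (subst differential_eqI) (auto simp: o_def differential_chart_at)
qed

lemma differential_const: "differential \<A> (\<lambda>q. k) p X = 0"
  by (subst differential_eqI) (auto simp: o_def)

text \<open>The domain of a chart is an open part of \<open>M\<close>, so \<open>f\<close> and \<open>g\<close> agree near \<open>p\<close> in the chart. They
  thus have the same set of derivatives there, from which \<open>frechet_derivative\<close> chooses, and the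
  choice is the same even if that set is empty.\<close>

lemma differential_cong:
  assumes "smooth_surface M \<A>" "p \<in> M" "\<And>q. q \<in> M \<Longrightarrow> f q = g q"
  shows "differential \<A> f p X = differential \<A> g p X"
proof -
  define c where "c = chart_at \<A> p"
  have c: "c \<in> \<A>" "p \<in> fst c"
    using chart_at[OF assms(1,2)] by (auto simp: c_def)
  have "((f \<circ> param c) has_derivative D) (at (snd c p)) \<longleftrightarrow>
      ((g \<circ> param c) has_derivative D) (at (snd c p))" for D
    using c assms chart_image(1,2)[OF assms(1) c(1)]
    by (auto elim!: has_derivative_transform_within_open[where s = "snd c ` fst c"])
  then show ?thesis
    by (simp add: differential_chart_at c_def[symmetric] frechet_derivative_def)
qed

section \<open>The Levi-Civita connection of hyperbolic space\<close>

definition hyp_param_deriv :: "real^3 \<Rightarrow> real^3 \<Rightarrow> real^4" where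
  "hyp_param_deriv y h = vector [(y \<bullet> h) / sqrt (1 + y \<bullet> y), h$1, h$2, h$3]"

lemma real_vec_3_inner: "(x::real^3) \<bullet> y = x$1 * y$1 + x$2 * y$2 + x$3 * y$3"
  by (simp add: inner_vec_def sum_3)

lemma one_plus_inner_pos: "1 + (y::'a::real_inner) \<bullet> y > 0"
  by (simp add: add_pos_nonneg)

lemma vector_4_nth:
  "(vector [a, b, c, d] :: 'a::zero^4) $ 1 = a"
  "(vector [a, b, c, d] :: 'a::zero^4) $ 2 = b"
  "(vector [a, b, c, d] :: 'a::zero^4) $ 3 = c"
  "(vector [a, b, c, d] :: 'a::zero^4) $ 4 = d"
  by (simp_all add: vector_def)

lemma hyp_param_has_derivative: "(hyp_param has_derivative hyp_param_deriv y) (at y)"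
proof -
  define L where "L h = (vector [0, h$1, h$2, h$3] :: real^4)" for h :: "real^3"
  have split: "vector [a, h$1, h$2, h$3] = a *\<^sub>R e1 + L h" for a and h :: "real^3"
    by (simp add: vec_eq_iff forall_4 vector_4_nth L_def e1_def axis_def)
  have "bounded_linear L"
    unfolding linear_conv_bounded_linear[symmetric] L_def
    by (auto intro!: linearI simp: vec_eq_iff forall_4 vector_4_nth)
  then have L: "(L has_derivative L) (at y)"
    by (rule bounded_linear_imp_has_derivative)
  have "((\<lambda>y. sqrt (1 + y \<bullet> y)) has_derivative (\<lambda>h. (y \<bullet> h) / sqrt (1 + y \<bullet> y))) (at y)"
    using one_plus_inner_pos[of y]
    by (auto intro!: derivative_eq_intros simp: inner_commute field_simps)
  then show ?thesis
    unfolding hyp_param_def[abs_def] hyp_param_deriv_def[abs_def] split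
    by (intro has_derivative_add has_derivative_scaleR_left L)
qed

lemma frechet_derivative_hyp_param: "frechet_derivative hyp_param (at y) = hyp_param_deriv y"
  using frechet_derivative_at[OF hyp_param_has_derivative] by simp

lemma hyp_coord_nth: "hyp_coord x $ 1 = x $ 2" "hyp_coord x $ 2 = x $ 3" "hyp_coord x $ 3 = x $ 4"
  by (simp_all add: hyp_coord_def)

lemma bounded_linear_hyp_coord: "bounded_linear hyp_coord"
  unfolding linear_conv_bounded_linear[symmetric]
  by (auto intro!: linearI simp: vec_eq_iff forall_3 hyp_coord_nth)

lemma H3_first_coord:
  assumes "p \<in> H3"
  shows "p $ 1 = sqrt (1 + hyp_coord p \<bullet> hyp_coord p)"
  using assms by (intro real_sqrt_unique[symmetric])
    (auto simp: H3_def lor_def real_vec_3_inner hyp_coord_nth power2_eq_square)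

lemma hyp_param_in_H3: "hyp_param y \<in> H3"
  using one_plus_inner_pos[of y]
  by (simp add: H3_def lor_def hyp_param_def vector_4_nth real_vec_3_inner)

lemma hyp_param_hyp_coord: "p \<in> H3 \<Longrightarrow> hyp_param (hyp_coord p) = p"
  by (simp add: hyp_param_def vec_eq_iff forall_4 vector_4_nth hyp_coord_nth H3_first_coord)

text \<open>For \<open>u\<close> tangent to \<open>H3\<close> at \<open>p\<close>, the equation \<open>lor p u = 0\<close> determines the first coordinate of \<open>u\<close>
  from the other three, which are its components in the chart.\<close>

lemma hyp_param_deriv_hyp_coord:
  assumes "p \<in> H3" "lor p u = 0"
  shows "hyp_param_deriv (hyp_coord p) (hyp_coord u) = u"
proof -
  have "p $ 1 > 0"
    using assms(1) by (simp add: H3_def)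
  moreover have "hyp_coord p \<bullet> hyp_coord u = p $ 1 * u $ 1"
    using assms(2) by (simp add: real_vec_3_inner hyp_coord_nth lor_def)
  ultimately show ?thesis
    by (simp add: hyp_param_deriv_def H3_first_coord[OF assms(1), symmetric] vec_eq_iff forall_4
        vector_4_nth hyp_coord_nth)
qed

text \<open>In the chart, straight segments provide curves with any prescribed velocity that are defined
  for all times.\<close>

lemma tangent_space_H3:
  assumes "p \<in> H3"
  shows "u \<in> tangent_space H3 p \<longleftrightarrow> lor p u = 0"
proof
  assume u: "lor p u = 0"
  define c where "c t = hyp_coord p + t *\<^sub>R hyp_coord u" for t
  have "(c has_vector_derivative hyp_coord u) (at 0)"
    unfolding c_def by (auto intro!: derivative_eq_intros)
  from has_derivative_compose[OF this[unfolded has_vector_derivative_def] hyp_param_has_derivative]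
  have "((\<lambda>t. hyp_param (c t)) has_derivative
      (\<lambda>t. hyp_param_deriv (hyp_coord p) (t *\<^sub>R hyp_coord u))) (at 0)"
    by (simp add: c_def)
  moreover have "hyp_param_deriv (hyp_coord p) (t *\<^sub>R hyp_coord u) = t *\<^sub>R u" for t
    using hyp_param_deriv_hyp_coord[OF assms, of "t *\<^sub>R u"] u
    by (simp add: lor.scaleR_right linear_simps[OF bounded_linear_hyp_coord])
  ultimately have "((\<lambda>t. hyp_param (c t)) has_vector_derivative u) (at 0)"
    by (simp add: has_vector_derivative_def)
  moreover have "hyp_param (c 0) = p"
    by (simp add: c_def hyp_param_hyp_coord assms)
  ultimately show "u \<in> tangent_space H3 p"
    unfolding tangent_space_def
    by (intro CollectI exI[of _ "\<lambda>t. hyp_param (c t)"]) (simp add: hyp_param_in_H3)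
qed (rule tangent_space_H3_orthogonal)

lemma hyp_metric_nth:
  "hyp_metric y $ i $ j = axis i 1 $ j - y $ i * y $ j / (1 + y \<bullet> y)"
proof -
  have "sqrt (1 + y \<bullet> y) * sqrt (1 + y \<bullet> y) = 1 + y \<bullet> y"
    using one_plus_inner_pos[of y] by simp
  moreover have "partial i hyp_param y =
      vector [y $ i / sqrt (1 + y \<bullet> y), axis i 1 $ 1, axis i 1 $ 2, axis i 1 $ 3]" for i
    by (simp add: partial_def frechet_derivative_hyp_param hyp_param_deriv_def inner_axis)
  ultimately show ?thesis
    using exhaust_3[of i] exhaust_3[of j]
    by (auto simp: hyp_metric_def lor_def vector_4_nth axis_def)
qed

text \<open>A rank-one perturbation of the identity has an inverse of the same kind. The coefficient becomes
  \<open>1\<close> because \<open>1 - (y \<bullet> y) / D = 1 / D\<close> for \<open>D = 1 + y \<bullet> y\<close>.\<close>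

lemma matrix_inv_hyp_metric: "matrix_inv (hyp_metric y) $ k $ l = axis k 1 $ l + y $ k * y $ l"
proof -
  define D where "D = 1 + y \<bullet> y"
  have D: "D \<noteq> 0" "y $ 1 * y $ 1 + y $ 2 * y $ 2 + y $ 3 * y $ 3 = D - 1"
    using one_plus_inner_pos[of y] by (auto simp: D_def real_vec_3_inner)
  define h :: "real^3^3" where "h = (\<chi> k l. axis k 1 $ l + y $ k * y $ l)"
  have "(hyp_metric y ** h) $ i $ j = mat 1 $ i $ j" for i j
  proof -
    have "(hyp_metric y ** h) $ i $ j
        = axis i 1 $ j + y $ i * y $ j - y $ i * y $ j / D
          - y $ i * y $ j / D * (y $ 1 * y $ 1 + y $ 2 * y $ 2 + y $ 3 * y $ 3)"
      using exhaust_3[of i] exhaust_3[of j]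
      by (auto simp: matrix_matrix_mult_def hyp_metric_nth D_def[symmetric] h_def sum_3 axis_def
          algebra_simps)
    also have "\<dots> = axis i 1 $ j"
      unfolding D(2) using D(1) by (simp add: field_simps)
    finally show ?thesis
      by (simp add: mat_def axis_def)
  qed
  then have "matrix_inv (hyp_metric y) = h"
    by (intro matrix_inv_eqI) (simp add: vec_eq_iff)
  then show ?thesis
    by (simp add: h_def)
qed

lemma partial_hyp_metric:
  "partial i (\<lambda>z. hyp_metric z $ j $ l) y =
     2 * y $ i * y $ j * y $ l / (1 + y \<bullet> y)\<^sup>2
       - (axis i 1 $ j * y $ l + y $ j * axis i 1 $ l) / (1 + y \<bullet> y)"
proof -
  have nth: "((\<lambda>z::real^3. z $ m) has_derivative (\<lambda>h. h $ m)) (at y)" for m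
    by (rule bounded_linear_imp_has_derivative[OF bounded_linear_vec_nth])
  have num: "((\<lambda>z::real^3. z $ j * z $ l) has_derivative (\<lambda>h. y $ j * h $ l + h $ j * y $ l)) (at y)"
    by (rule has_derivative_mult[OF nth nth])
  have den: "((\<lambda>z::real^3. 1 + z \<bullet> z) has_derivative (\<lambda>h. 2 * (y \<bullet> h))) (at y)"
    by (auto intro!: derivative_eq_intros simp: inner_commute)
  define D where "D = 1 + y \<bullet> y"
  have D: "1 + y \<bullet> y \<noteq> 0" "D \<noteq> 0"
    using one_plus_inner_pos[of y] by (auto simp: D_def)
  from has_derivative_diff[OF has_derivative_const has_derivative_divide'[OF num den D(1)]]
  have deriv: "((\<lambda>z::real^3. axis j 1 $ l - z $ j * z $ l / (1 + z \<bullet> z)) has_derivative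
      (\<lambda>h. 0 - ((y $ j * h $ l + h $ j * y $ l) * D - y $ j * y $ l * (2 * (y \<bullet> h))) / (D * D)))
      (at y)"
    unfolding D_def .
  show ?thesis
    unfolding partial_def hyp_metric_nth frechet_derivative_at[OF deriv, symmetric] D_def[symmetric]
    using D(2) by (simp add: inner_axis field_simps power2_eq_square)
qed

text \<open>With \<open>D = 1 + y \<bullet> y\<close>, the Christoffel symbols of the first kind are \<open>- y\<^sub>l g\<^sub>i\<^sub>j / D\<close>; raising
  the index replaces \<open>y\<^sub>l\<close> by \<open>D y\<^sub>k\<close>. The result is the chart form of the geodesic equation of the hyperboloid: the second
  derivative of the position vector is the squared speed times the position vector itself.\<close>

lemma christoffel_hyp_metric:
  "christoffel hyp_metric k i j y = - (y $ k * hyp_metric y $ i $ j)"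
proof -
  define D where "D = 1 + y \<bullet> y"
  have D: "D \<noteq> 0" "y $ 1 * y $ 1 + y $ 2 * y $ 2 + y $ 3 * y $ 3 = D - 1"
    using one_plus_inner_pos[of y] by (auto simp: D_def real_vec_3_inner)
  have ax: "axis a (1::real) $ b = axis b 1 $ a" for a b :: 3
    by (simp add: axis_def)
  define c where "c = hyp_metric y $ i $ j / D"
  have first_kind: "partial i (\<lambda>z. hyp_metric z $ j $ l) y + partial j (\<lambda>z. hyp_metric z $ i $ l) y
      - partial l (\<lambda>z. hyp_metric z $ i $ j) y = - 2 * c * y $ l" for l
    unfolding partial_hyp_metric c_def
    unfolding hyp_metric_nth D_def[symmetric] ax[of l] ax[of j i] using D(1)
    by (simp add: field_simps power2_eq_square)
  have "christoffel hyp_metric k i j y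
      = - c * (\<Sum>l\<in>UNIV. (axis k 1 $ l + y $ k * y $ l) * y $ l)"
    unfolding christoffel_def matrix_inv_hyp_metric first_kind
    by (simp add: sum_3 field_simps)
  also have "(\<Sum>l\<in>UNIV. (axis k 1 $ l + y $ k * y $ l) * y $ l)
      = y $ k + y $ k * (y $ 1 * y $ 1 + y $ 2 * y $ 2 + y $ 3 * y $ 3)"
    using exhaust_3[of k] by (auto simp: sum_3 axis_def algebra_simps)
  also have "\<dots> = y $ k * D"
    unfolding D(2) by (simp add: algebra_simps)
  finally show ?thesis
    using D(1) by (simp add: c_def)
qed

lemma hyp_metric_eq_lor:
  assumes "p \<in> H3" "lor p u = 0" "lor p v = 0"
  shows "(\<Sum>i\<in>UNIV. \<Sum>j\<in>UNIV. hyp_metric (hyp_coord p) $ i $ j * hyp_coord u $ i * hyp_coord v $ j)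
    = lor u v"
proof -
  define y where "y = hyp_coord p"
  define c where "c = inverse (1 + y \<bullet> y)"
  have g: "hyp_metric y $ i $ j = axis i 1 $ j - c * y $ i * y $ j" for i j
    by (simp add: hyp_metric_nth c_def divide_inverse)
  have "sqrt (1 + y \<bullet> y) * sqrt (1 + y \<bullet> y) = 1 + y \<bullet> y"
    using one_plus_inner_pos[of y] by simp
  then have "lor (hyp_param_deriv y a) (hyp_param_deriv y b) = a \<bullet> b - c * (y \<bullet> a) * (y \<bullet> b)" for a b
    by (simp add: lor_def hyp_param_deriv_def vector_4_nth c_def divide_inverse real_vec_3_inner[of a]
        flip: inverse_mult_distrib)
  also have "a \<bullet> b - c * (y \<bullet> a) * (y \<bullet> b)
      = (\<Sum>i\<in>UNIV. \<Sum>j\<in>UNIV. hyp_metric y $ i $ j * a $ i * b $ j)" for a b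
    by (simp add: g sum_3 axis_def real_vec_3_inner algebra_simps)
  finally have "(\<Sum>i\<in>UNIV. \<Sum>j\<in>UNIV. hyp_metric y $ i $ j * a $ i * b $ j)
      = lor (hyp_param_deriv y a) (hyp_param_deriv y b)" for a b
    by simp
  then show ?thesis
    by (simp add: y_def hyp_param_deriv_hyp_coord assms)
qed

lemma differential_tangent:
  assumes "smooth_surface M \<A>" "p \<in> M" "smooth_map \<A> F" "F ` M \<subseteq> H3"
  shows "lor (F p) (differential \<A> F p X) = 0"
proof -
  have "differential \<A> (\<lambda>q. lor (F q) (F q)) p X = differential \<A> (\<lambda>q. -1) p X"
    using assms by (intro differential_cong) (auto intro!: H3_lor)
  then show ?thesis
    using differential_bounded_bilinear[OF assms(1,2,3,3) bounded_bilinear_lor, of X]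
    by (simp add: differential_const lor_commute)
qed

text \<open>The Gauss formula of the hyperboloid: the covariant derivative is the tangential part of the
  derivative in the ambient space. The normal component is found by differentiating
  \<open>lor (F q) (V q) = 0\<close>, and in the chart it is exactly what the Christoffel symbols subtract.\<close>

lemma nabla_eq:
  assumes "smooth_surface M \<A>" "p \<in> M" "smooth_map \<A> F" "F ` M \<subseteq> H3"
    and "smooth_map \<A> V" "\<And>q. q \<in> M \<Longrightarrow> lor (F q) (V q) = 0"
  shows "nabla \<A> F V p X
    = differential \<A> V p X - lor (differential \<A> F p X) (V p) *\<^sub>R F p"
proof -
  define dF where "dF = differential \<A> F p X"
  define dV where "dV = differential \<A> V p X"
  have p: "F p \<in> H3"
    using assms by blast
  have dF: "lor (F p) dF = 0"
    unfolding dF_def by (rule differential_tangent) fact+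
  have "differential \<A> (\<lambda>q. lor (F q) (V q)) p X = differential \<A> (\<lambda>q. 0) p X"
    using assms by (intro differential_cong) auto
  then have dV: "lor (F p) dV = - lor dF (V p)"
    using differential_bounded_bilinear[OF assms(1,2,3,5) bounded_bilinear_lor, of X]
    by (simp add: differential_const dF_def dV_def)
  \<comment> \<open>The candidate for the covariant derivative; it is tangent, so its chart components recover it.\<close>
  define w where "w = dV - lor dF (V p) *\<^sub>R F p"
  have w: "lor (F p) w = 0"
    by (simp add: w_def lor.diff_right lor.scaleR_right dV H3_lor p)
  have coord: "differential \<A> (\<lambda>q. hyp_coord (V q)) p X = hyp_coord dV"
    "differential \<A> (\<lambda>q. hyp_coord (F q)) p X = hyp_coord dF"
    unfolding dV_def dF_def
    by (intro differential_bounded_linear[OF assms(1,2)] bounded_linear_hyp_coord assms)+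
  have "(\<Sum>i\<in>UNIV. \<Sum>j\<in>UNIV. christoffel hyp_metric k i j (hyp_coord (F p)) *
             hyp_coord dF $ i * hyp_coord (V p) $ j) = - (hyp_coord (F p) $ k * lor dF (V p))" for k
    unfolding hyp_metric_eq_lor[OF p dF assms(6)[OF assms(2)], symmetric]
    by (simp add: christoffel_hyp_metric sum_distrib_left sum_negf[symmetric] mult.assoc)
  then have "nabla \<A> F V p X = hyp_param_deriv (hyp_coord (F p))
      (\<chi> k. hyp_coord dV $ k - hyp_coord (F p) $ k * lor dF (V p))"
    by (simp add: nabla_def coord frechet_derivative_hyp_param)
  also have "(\<chi> k. hyp_coord dV $ k - hyp_coord (F p) $ k * lor dF (V p)) = hyp_coord w"
    by (simp add: vec_eq_iff w_def linear_simps[OF bounded_linear_hyp_coord])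
  also have "hyp_param_deriv (hyp_coord (F p)) (hyp_coord w) = w"
    by (rule hyp_param_deriv_hyp_coord[OF p w])
  finally show ?thesis
    by (simp add: w_def dV_def dF_def)
qed

section \<open>The differential of the Gauss map\<close>

theorem proposition6:
  fixes M :: "'m::{t2_space,second_countable_topology} set"
    and \<A> :: "'m chart set"
    and F \<eta> :: "'m \<Rightarrow> real^4"
    and p :: 'm
    and X Y :: "'m chart \<Rightarrow> real^2"
  assumes "smooth_surface M \<A>"
    and "immersed_in_H3 M \<A> F"
    and "unit_normal_field M \<A> F \<eta>"
    and "p \<in> M"
    and "X \<in> surface_tangent \<A> p"
    and "Y \<in> surface_tangent \<A> p"
  shows "lie_form (differential \<A> (gauss_map F \<eta>) p X) (Gamma_map (F p) (differential \<A> F p Y))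
           = - lor (shape_operator \<A> F \<eta> p X) (differential \<A> F p Y)"
proof -
  note surf = assms(1,4)
  have F: "smooth_map \<A> F" "F ` M \<subseteq> H3"
    using assms(2) by (auto simp: immersed_in_H3_def)
  have \<eta>: "smooth_map \<A> \<eta>"
    and \<eta>_tangent: "\<And>q. q \<in> M \<Longrightarrow> \<eta> q \<in> tangent_space H3 (F q)"
    and \<eta>_normal: "\<And>Z. Z \<in> surface_tangent \<A> p \<Longrightarrow> lor (\<eta> p) (differential \<A> F p Z) = 0"
    using assms(3,4) by (auto simp: unit_normal_field_def)
  have p: "F p \<in> H3"
    using F assms(4) by blast
  define dX where "dX = differential \<A> F p X"
  define dY where "dY = differential \<A> F p Y"
  define d\<eta> where "d\<eta> = differential \<A> \<eta> p X"
  have tangent: "lor (F p) dX = 0" "lor (F p) dY = 0"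
    unfolding dX_def dY_def by (rule differential_tangent[OF surf F])+
  have normal: "lor (\<eta> p) dX = 0" "lor (\<eta> p) dY = 0"
    unfolding dX_def dY_def by (rule \<eta>_normal assms)+
  have \<eta>_F: "lor (F q) (\<eta> q) = 0" if "q \<in> M" for q
    using \<eta>_tangent[OF that] by (rule tangent_space_H3_orthogonal)
  have "differential \<A> (gauss_map F \<eta>) p X = differential \<A> (\<lambda>q. wedge (F q) (\<eta> q)) p X"
    using F(2) \<eta>_tangent
    by (intro differential_cong[OF surf]) (auto simp: gauss_map_def intro!: Gamma_map_eq_wedge)
  also have "\<dots> = wedge (F p) d\<eta> + wedge dX (\<eta> p)"
    unfolding dX_def d\<eta>_def by (rule differential_bounded_bilinear[OF surf F(1) \<eta> bounded_bilinear_wedge])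
  finally have gauss: "differential \<A> (gauss_map F \<eta>) p X = wedge (F p) d\<eta> + wedge dX (\<eta> p)" .
  have "Gamma_map (F p) dY = wedge (F p) dY"
    using tangent by (intro Gamma_map_eq_wedge) (auto simp: p tangent_space_H3)
  then have "lie_form (differential \<A> (gauss_map F \<eta>) p X) (Gamma_map (F p) dY)
      = lie_form (wedge (F p) d\<eta>) (wedge (F p) dY) + lie_form (wedge dX (\<eta> p)) (wedge (F p) dY)"
    by (simp add: gauss lie_form_def matrix_add_rdistrib trace_add add_divide_distrib)
  \<comment> \<open>The second summand vanishes since \<open>dY\<close> is orthogonal to both \<open>F p\<close> and \<open>\<eta> p\<close>; in the first
    one only \<open>lor (F p) (F p) = -1\<close> survives.\<close>
  also have "\<dots> = lor d\<eta> dY"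
    using tangent normal \<eta>_F[OF assms(4)]
    by (simp add: lie_form_wedge lor_commute[of dX "F p"] lor_commute[of dY "F p"]
        lor_commute[of "\<eta> p" "F p"] H3_lor p)
  \<comment> \<open>The two sides could only differ by a multiple of \<open>F p\<close>, with the factor \<open>lor dX (\<eta> p) = 0\<close>.\<close>
  also have "\<dots> = lor (nabla \<A> F \<eta> p X) dY"
    using normal nabla_eq[OF surf F \<eta> \<eta>_F, of X]
    by (simp add: dX_def[symmetric] d\<eta>_def[symmetric] lor_commute[of dX])
  finally show ?thesis
    by (simp add: shape_operator_def dY_def[symmetric] lor.minus_left)
qed

end
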